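(* Let $\alpha$ be a smooth function of involutive type and of non-generic type and let $\mathcal I=\{dz-p\,dx-q\,dy,\ dp-\alpha\,dq\}_{\mathrm{diff}}$. Let $\xi(t)$ be an arbitrary smooth function, and let $\mu(t)$ be a solution of the ordinary differential equation (for the unknown function $x_2(t)$) $$\frac{dx_2}{dt}+\overline\beta(\xi'(t),x_2(t),\xi(t),t)=0.$$ Then $$S_2:=\{(s,\varphi_2(s,\xi'(t),\mu(t),\xi(t),t),\psi_2(s,\xi'(t),\mu(t),\xi(t),t),\xi(t),t)\mid s\in I_2,\ t\in J_2\}\subset J^1(2,1)$$ is a two-dimensional integral manifold of $\mathcal I$, where $I_2$ and $J_2$ are some open intervals in $\mathbb R$.
   Context: All objects are $C^\infty$ and all considerations are local. $J^1(2,1)=PT^*J^0(2,1)$, where $J^0(2,1)$ is a three-dimensional manifold, with canonical local coordinates $(x,y,z,p,q)$ in which the contact form is $dz-p\,dx-q\,dy$. $\{\omega_1,\dots,\omega_r\}_{\mathrm{diff}}$ denotes the ideal of differential forms generated by the $\omega_i$ and $d\omega_i$. An integral manifold of an ideal $\mathcal J$ on $M$ is a submanifold $\iota\colon N\hookrightarrow M$ with $\iota^*\mathcal J=\{0\}$. The function $\alpha=\alpha(x,y,z,p,q)$ is of involutive type if $\alpha_x+p\alpha_z-\alpha(\alpha_y+q\alpha_z)=0$ on its domain, and of non-generic type if $1+x(\alpha_y+q\alpha_z)=0$ on its domain. Define $\Phi_2(x,y,z,p,q)=(x_0,x_1,x_2,x_3,x_4)$ by $$x_0=x,\quad x_1=\alpha,\quad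 x_2=z-px-qy,\quad x_3=p,\quad x_4=q .$$ For non-generic $\alpha$ this is a local diffeomorphism; fix a local inverse $\Phi_2^{-1}$ on an open set $V_2\subset\mathbb R\times U_2$ (with $U_2\subset\mathbb R^4$ open with coordinates $(x_1,\dots,x_4)$, taken so that $V_2$ is the product of an open interval and $U_2$), and denote by $\varphi_2$ and $\psi_2$ the second ($y$) and third ($z$) components of $\Phi_2^{-1}$. Put $\beta=y+\alpha x$ and $\overline\beta=\beta\circ\Phi_2^{-1}$; $\overline\beta$ does not depend on $x_0$, and it is regarded as a function $\overline\beta(x_1,x_2,x_3,x_4)$ on $U_2$. The intervals $I_2,J_2$ are such that $(s,\xi'(t),\mu(t),\xi(t),t)\in V_2$ for $s\in I_2,t\in J_2$. *)

theory Defs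
  imports "HOL-Analysis.Analysis"
begin

section \<open>Smooth maps and submanifolds\<close>

text \<open>Meant for open \<open>S\<close>: all iterated directional derivatives up to order \<open>n\<close> exist, and those of
  order \<open>n\<close> are continuous.\<close>

primrec Ck_on :: "nat \<Rightarrow> 'a::real_normed_vector set \<Rightarrow> ('a \<Rightarrow> 'b::real_normed_vector) \<Rightarrow> bool" where
  "Ck_on 0 S f \<longleftrightarrow> continuous_on S f"
| "Ck_on (Suc n) S f \<longleftrightarrow>
     (\<forall>x\<in>S. f differentiable at x) \<and> (\<forall>v. Ck_on n S (\<lambda>x. frechet_derivative f (at x) v))"

definition smooth_on :: "'a::real_normed_vector set \<Rightarrow> ('a \<Rightarrow> 'b::real_normed_vector) \<Rightarrow> bool" where
  "smooth_on S f \<longleftrightarrow> (\<forall>n. Ck_on n S f)"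

definition diffeomorphism ::
  "'a::real_normed_vector set \<Rightarrow> 'b::real_normed_vector set \<Rightarrow> ('a \<Rightarrow> 'b) \<Rightarrow> ('b \<Rightarrow> 'a) \<Rightarrow> bool" where
  "diffeomorphism U V f g \<longleftrightarrow>
     open U \<and> open V \<and> smooth_on U f \<and> smooth_on V g \<and> f ` U = V \<and> g ` V = U \<and>
     (\<forall>u\<in>U. g (f u) = u) \<and> (\<forall>v\<in>V. f (g v) = v)"

definition local_inverse ::
  "'a::real_normed_vector set \<Rightarrow> ('a \<Rightarrow> 'b::real_normed_vector) \<Rightarrow> 'b set \<Rightarrow> ('b \<Rightarrow> 'a) \<Rightarrow> bool" where
  "local_inverse M f V g \<longleftrightarrow> (\<exists>W\<subseteq>M. diffeomorphism W V f g)"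

text \<open>Embedded submanifolds of dimension \<open>k\<close>, by the local slice condition: near each of its points,
  \<open>S\<close> is straightened to a \<open>k\<close>-dimensional linear subspace by a diffeomorphism of the ambient space.\<close>

definition submanifold :: "nat \<Rightarrow> 'a::euclidean_space set \<Rightarrow> 'a set \<Rightarrow> bool" where
  "submanifold k M S \<longleftrightarrow> S \<subseteq> M \<and>
     (\<forall>P\<in>S. \<exists>U V (f :: 'a \<Rightarrow> 'a) g L.
        P \<in> U \<and> diffeomorphism U V f g \<and> subspace L \<and> dim L = k \<and> f ` (S \<inter> U) = L \<inter> V)"

text \<open>Velocities of smooth curves that stay in \<open>S\<close>.\<close>

definition tangent_space :: "'a::real_normed_vector set \<Rightarrow> 'a \<Rightarrow> 'a set" where
  "tangent_space S P = {v. \<exists>\<gamma> \<epsilon>. \<epsilon> > 0 \<and> smooth_on {-\<epsilon><..<\<epsilon>} \<gamma> \<and> \<gamma> ` {-\<epsilon><..<\<epsilon>} \<subseteq> S \<and>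
     \<gamma> 0 = P \<and> (\<gamma> has_vector_derivative v) (at (0::real))}"


section \<open>Differential forms on open subsets of a Euclidean space\<close>

text \<open>A form of possibly mixed degree: \<open>\<omega> P\<close> restricted to lists of length \<open>k\<close> is the component of
  degree \<open>k\<close> at the point \<open>P\<close>, an alternating \<open>k\<close>-linear map on the tangent space. In degrees above
  the dimension it is automatically zero. The values of \<open>\<omega>\<close> off the domain are irrelevant.\<close>

type_synonym 'a form = "'a \<Rightarrow> 'a list \<Rightarrow> real"

definition forms_on :: "'a::euclidean_space set \<Rightarrow> 'a form set" where
  "forms_on M = {\<omega>.
     (\<forall>vs. smooth_on M (\<lambda>P. \<omega> P vs)) \<and>
     (\<forall>P\<in>M. \<forall>vs. \<forall>i<length vs. linear (\<lambda>v. \<omega> P (vs[i := v]))) \<and>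
     (\<forall>P\<in>M. \<forall>vs i j. i < j \<and> j < length vs \<and> vs ! i = vs ! j \<longrightarrow> \<omega> P vs = 0)}"

definition form_of_fun :: "('a \<Rightarrow> real) \<Rightarrow> 'a form" where
  "form_of_fun f = (\<lambda>P vs. if vs = [] then f P else 0)"

text \<open>The sum over shuffles: \<open>S\<close> is the set of positions of the arguments passed to \<open>\<omega>\<close>, and the sign
  is that of the permutation moving them to the front. No factorials occur, so that
  \<open>(dx \<and> dy)(v, w) = dx(v) dy(w) - dx(w) dy(v)\<close>.\<close>

definition wedge :: "'a form \<Rightarrow> 'a form \<Rightarrow> 'a form" where
  "wedge \<omega> \<eta> = (\<lambda>P vs. \<Sum>S\<in>Pow {..<length vs}.
     (-1) ^ card {(i, j). i \<in> S \<and> j \<in> {..<length vs} - S \<and> j < i} *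
     \<omega> P (nths vs S) * \<eta> P (nths vs (- S)))"

text \<open>The invariant formula for the exterior derivative, with constant vector fields as arguments,
  so that there are no bracket terms.\<close>

definition ext_d :: "'a::real_normed_vector form \<Rightarrow> 'a form" where
  "ext_d \<omega> = (\<lambda>P vs. \<Sum>i<length vs.
     (-1) ^ i * frechet_derivative (\<lambda>Q. \<omega> Q (take i vs @ drop (Suc i) vs)) (at P) (vs ! i))"

text \<open>The ideal of the ring of differential forms on \<open>M\<close> generated by the members of \<open>G\<close> and
  their exterior derivatives.\<close>

inductive_set diff_ideal :: "'a::euclidean_space set \<Rightarrow> 'a form set \<Rightarrow> 'a form set"
  for M G where
  gen: "\<omega> \<in> G \<Longrightarrow> \<omega> \<in> diff_ideal M G"
| gen_d: "\<omega> \<in> G \<Longrightarrow> ext_d \<omega> \<in> diff_ideal M G"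
| zero: "(\<lambda>P vs. 0) \<in> diff_ideal M G"
| add: "\<omega> \<in> diff_ideal M G \<Longrightarrow> \<eta> \<in> diff_ideal M G \<Longrightarrow> (\<lambda>P vs. \<omega> P vs + \<eta> P vs) \<in> diff_ideal M G"
| wedge_left: "\<eta> \<in> forms_on M \<Longrightarrow> \<omega> \<in> diff_ideal M G \<Longrightarrow> wedge \<eta> \<omega> \<in> diff_ideal M G"
| wedge_right: "\<omega> \<in> diff_ideal M G \<Longrightarrow> \<eta> \<in> forms_on M \<Longrightarrow> wedge \<omega> \<eta> \<in> diff_ideal M G"

text \<open>The pullback of \<open>\<omega>\<close> along the inclusion of \<open>S\<close> is the restriction of \<open>\<omega>\<close> to tangent vectors
  of \<open>S\<close>.\<close>

definition pullback_vanishes :: "'a::euclidean_space set \<Rightarrow> 'a form \<Rightarrow> bool" where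
  "pullback_vanishes S \<omega> \<longleftrightarrow> (\<forall>P\<in>S. \<forall>vs. set vs \<subseteq> tangent_space S P \<longrightarrow> \<omega> P vs = 0)"

definition integral_manifold ::
  "nat \<Rightarrow> 'a::euclidean_space set \<Rightarrow> 'a form set \<Rightarrow> 'a set \<Rightarrow> bool" where
  "integral_manifold k M \<J> S \<longleftrightarrow> submanifold k M S \<and> (\<forall>\<omega>\<in>\<J>. pullback_vanishes S \<omega>)"


section \<open>The system on the jet space\<close>

text \<open>Points are \<open>(x, y, z, p, q)\<close>; the same type serves for \<open>(x\<^sub>0, x\<^sub>1, x\<^sub>2, x\<^sub>3, x\<^sub>4)\<close>.\<close>

type_synonym jet = "real \<times> real \<times> real \<times> real \<times> real"

definition involutive_type :: "jet set \<Rightarrow> (jet \<Rightarrow> real) \<Rightarrow> bool" where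
  "involutive_type M \<alpha> \<longleftrightarrow> (\<forall>(x, y, z, p, q)\<in>M.
     deriv (\<lambda>s. \<alpha> (s, y, z, p, q)) x + p * deriv (\<lambda>s. \<alpha> (x, y, s, p, q)) z
     - \<alpha> (x, y, z, p, q) *
         (deriv (\<lambda>s. \<alpha> (x, s, z, p, q)) y + q * deriv (\<lambda>s. \<alpha> (x, y, s, p, q)) z) = 0)"

definition non_generic_type :: "jet set \<Rightarrow> (jet \<Rightarrow> real) \<Rightarrow> bool" where
  "non_generic_type M \<alpha> \<longleftrightarrow> (\<forall>(x, y, z, p, q)\<in>M.
     1 + x * (deriv (\<lambda>s. \<alpha> (x, s, z, p, q)) y + q * deriv (\<lambda>s. \<alpha> (x, y, s, p, q)) z) = 0)"

definition d_x :: "jet form" where "d_x = ext_d (form_of_fun (\<lambda>(x, y, z, p, q). x))"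
definition d_y :: "jet form" where "d_y = ext_d (form_of_fun (\<lambda>(x, y, z, p, q). y))"
definition d_z :: "jet form" where "d_z = ext_d (form_of_fun (\<lambda>(x, y, z, p, q). z))"
definition d_p :: "jet form" where "d_p = ext_d (form_of_fun (\<lambda>(x, y, z, p, q). p))"
definition d_q :: "jet form" where "d_q = ext_d (form_of_fun (\<lambda>(x, y, z, p, q). q))"

definition contact_form :: "jet form" where
  "contact_form = (\<lambda>(x, y, z, p, q) vs.
     d_z (x, y, z, p, q) vs - p * d_x (x, y, z, p, q) vs - q * d_y (x, y, z, p, q) vs)"

definition alpha_form :: "(jet \<Rightarrow> real) \<Rightarrow> jet form" where
  "alpha_form \<alpha> = (\<lambda>P vs. d_p P vs - \<alpha> P * d_q P vs)"

definition system_ideal :: "jet set \<Rightarrow> (jet \<Rightarrow> real) \<Rightarrow> jet form set" where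
  "system_ideal M \<alpha> = diff_ideal M {contact_form, alpha_form \<alpha>}"

definition Phi2 :: "(jet \<Rightarrow> real) \<Rightarrow> jet \<Rightarrow> jet" where
  "Phi2 \<alpha> = (\<lambda>(x, y, z, p, q). (x, \<alpha> (x, y, z, p, q), z - p * x - q * y, p, q))"

definition phi2 :: "(jet \<Rightarrow> jet) \<Rightarrow> jet \<Rightarrow> real" where
  "phi2 \<Psi> v = fst (snd (\<Psi> v))"

definition psi2 :: "(jet \<Rightarrow> jet) \<Rightarrow> jet \<Rightarrow> real" where
  "psi2 \<Psi> v = fst (snd (snd (\<Psi> v)))"

definition beta :: "(jet \<Rightarrow> real) \<Rightarrow> jet \<Rightarrow> real" where
  "beta \<alpha> = (\<lambda>(x, y, z, p, q). y + \<alpha> (x, y, z, p, q) * x)"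

text \<open>The common value of \<open>\<beta> \<circ> \<Psi>\<close> over all \<open>x\<^sub>0 \<in> A\<close>, where \<open>\<Psi>\<close> is the inverse of \<open>Phi2 \<alpha>\<close> on
  \<open>A \<times> U\<close>. That it exists is a consequence of the involutivity condition; nothing about
  independence of \<open>x\<^sub>0\<close> is assumed here.\<close>

definition beta_bar ::
  "real set \<Rightarrow> (jet \<Rightarrow> real) \<Rightarrow> (jet \<Rightarrow> jet) \<Rightarrow> real \<times> real \<times> real \<times> real \<Rightarrow> real" where
  "beta_bar A \<alpha> \<Psi> u = (THE b. \<forall>x\<^sub>0\<in>A. beta \<alpha> (\<Psi> (x\<^sub>0, u)) = b)"

definition open_interval :: "real set \<Rightarrow> bool" where
  "open_interval I \<longleftrightarrow> open I \<and> is_interval I \<and> I \<noteq> {}"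

text \<open>Being a solution includes that the right-hand side is evaluated inside its domain \<open>U\<close>.\<close>

definition solves_ode ::
  "real set \<Rightarrow> (real \<times> real \<times> real \<times> real) set \<Rightarrow> (real \<times> real \<times> real \<times> real \<Rightarrow> real) \<Rightarrow>
   (real \<Rightarrow> real) \<Rightarrow> (real \<Rightarrow> real) \<Rightarrow> bool" where
  "solves_ode J U b \<xi> \<mu> \<longleftrightarrow> (\<forall>t\<in>J. (deriv \<xi> t, \<mu> t, \<xi> t, t) \<in> U \<and>
     \<mu> differentiable at t \<and> deriv \<mu> t + b (deriv \<xi> t, \<mu> t, \<xi> t, t) = 0)"

definition S2 ::
  "(jet \<Rightarrow> jet) \<Rightarrow> (real \<Rightarrow> real) \<Rightarrow> (real \<Rightarrow> real) \<Rightarrow> real set \<Rightarrow> real set \<Rightarrow> jet set" where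
  "S2 \<Psi> \<xi> \<mu> I J = {(s, phi2 \<Psi> (s, deriv \<xi> t, \<mu> t, \<xi> t, t), psi2 \<Psi> (s, deriv \<xi> t, \<mu> t, \<xi> t, t), \<xi> t, t)
     | s t. s \<in> I \<and> t \<in> J}"

text \<open>\<open>J\<close> is the interval on which \<open>\<xi>\<close> and \<open>\<mu>\<close> are given.\<close>

definition admissible_intervals ::
  "jet set \<Rightarrow> real set \<Rightarrow> (real \<Rightarrow> real) \<Rightarrow> (real \<Rightarrow> real) \<Rightarrow> real set \<Rightarrow> real set \<Rightarrow> bool" where
  "admissible_intervals V J \<xi> \<mu> I2 J2 \<longleftrightarrow> open_interval I2 \<and> open_interval J2 \<and> J2 \<subseteq> J \<and>
     (\<forall>s\<in>I2. \<forall>t\<in>J2. (s, deriv \<xi> t, \<mu> t, \<xi> t, t) \<in> V)"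

end

theory Submission
  imports Defs
begin

text \<open>Along a line on which \<open>x\<^sub>1, \<dots>, x\<^sub>4\<close> are constant, \<open>\<alpha>\<close> is constant; the involutivity equation
  and \<open>\<alpha>\<^sub>y + q \<alpha>\<^sub>z \<noteq> 0\<close> (a consequence of non-genericity) then force \<open>dy/dx = -\<alpha>\<close>, so \<open>\<beta>\<close> is constant
  there and \<open>\<beta>\<close>-bar is smooth, whence \<open>\<mu>\<close> is smooth by bootstrapping its equation.

  In the coordinates given by \<open>\<Phi>\<^sub>2\<close> the surface is a graph over the \<open>(x\<^sub>0, x\<^sub>4)\<close>-plane, hence a
  submanifold, without any immersion argument. On it \<open>p = \<xi>(q)\<close>, \<open>\<alpha> = \<xi>'(q)\<close>,
  \<open>z - p x - q y = \<mu>(q)\<close> and \<open>y + \<xi>'(q) x = -\<mu>'(q)\<close>; differentiating these equations shows that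
  the two one-forms and their exterior derivatives vanish on tangent vectors.\<close>

section \<open>Calculus of smooth maps\<close>

lemma Ck_on_SucI:
  assumes "open S" and "\<And>x. x \<in> S \<Longrightarrow> (f has_derivative f' x) (at x)"
    and "\<And>v. Ck_on n S (\<lambda>x. frechet_derivative f (at x) v)"
  shows "Ck_on (Suc n) S f"
  using assms by (auto simp: differentiable_def)

text \<open>A derivative depends only on values near the point, so on an open set agreement of two
  maps passes to all their directional derivatives.\<close>

lemma Ck_on_cong:
  assumes "open S" "Ck_on n S f" "\<And>x. x \<in> S \<Longrightarrow> f x = g x"
  shows "Ck_on n S g"
  using assms
proof (induction n arbitrary: f g)
  case 0
  then show ?case by (simp cong: continuous_on_cong)
next
  case (Suc n)
  have D: "(g has_derivative frechet_derivative f (at x)) (at x)" if "x \<in> S" for x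
    using Suc.prems that frechet_derivative_works[of f "at x"]
    by (auto intro: has_derivative_transform_within_open)
  have "Ck_on n S (\<lambda>x. frechet_derivative g (at x) v)" for v
  proof (rule Suc.IH)
    show "Ck_on n S (\<lambda>x. frechet_derivative f (at x) v)" using Suc.prems by simp
    show "frechet_derivative f (at x) v = frechet_derivative g (at x) v" if "x \<in> S" for x
      using frechet_derivative_at[OF D[OF that]] by simp
  qed (use Suc.prems in auto)
  then show ?case using D Suc.prems by (intro Ck_on_SucI)
qed

text \<open>Allows work with explicit derivative formulas: uniqueness of the derivative identifies
  \<open>f'\<close> with the one chosen by \<open>frechet_derivative\<close>.\<close>

lemma Ck_on_Suc_derivI:
  assumes "open S" and D: "\<And>x. x \<in> S \<Longrightarrow> (f has_derivative f' x) (at x)"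
    and C: "\<And>v. Ck_on n S (\<lambda>x. f' x v)"
  shows "Ck_on (Suc n) S f"
proof (rule Ck_on_SucI[OF assms(1) D])
  show "Ck_on n S (\<lambda>x. frechet_derivative f (at x) v)" for v
    using C by (rule Ck_on_cong[OF assms(1)]) (use frechet_derivative_at[OF D] in simp)
qed

lemma Ck_on_Suc_derivD:
  assumes "Ck_on (Suc n) S f" "x \<in> S"
  shows "(f has_derivative frechet_derivative f (at x)) (at x)"
  using assms frechet_derivative_works by auto

lemma Ck_on_mono: "Ck_on n S f \<Longrightarrow> T \<subseteq> S \<Longrightarrow> Ck_on n T f"
  by (induction n arbitrary: f) (auto intro: continuous_on_subset)

text \<open>Only the lowest order has content: differentiability gives continuity. The product and
  chain rules need this because undifferentiated factors reappear in their derivatives.\<close>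

lemma Ck_on_lower: "Ck_on (Suc n) S f \<Longrightarrow> Ck_on n S f"
proof (induction n arbitrary: f)
  case 0
  then show ?case
    by (auto intro!: continuous_at_imp_continuous_on differentiable_imp_continuous_within)
qed auto

lemma Ck_on_const: "open S \<Longrightarrow> Ck_on n S (\<lambda>x. c)"
proof (induction n arbitrary: c)
  case (Suc n)
  show ?case
    by (rule Ck_on_Suc_derivI[where f' = "\<lambda>x v. 0"]) (use Suc in auto)
qed simp

lemma Ck_on_bounded_linear:
  assumes "open S" "bounded_linear h"
  shows "Ck_on n S h"
proof (cases n)
  case 0
  then show ?thesis using assms by (simp add: linear_continuous_on)
next
  case (Suc m)
  show ?thesis unfolding Suc
    by (rule Ck_on_Suc_derivI[where f' = "\<lambda>x. h"])
      (use assms Ck_on_const in \<open>auto intro: bounded_linear_imp_has_derivative\<close>)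
qed

lemma Ck_on_add:
  assumes "open S"
  shows "Ck_on n S f \<Longrightarrow> Ck_on n S g \<Longrightarrow> Ck_on n S (\<lambda>x. f x + g x)"
proof (induction n arbitrary: f g)
  case 0
  then show ?case by (auto intro: continuous_on_add)
next
  case (Suc n)
  show ?case
  proof (rule Ck_on_Suc_derivI[OF assms])
    show "((\<lambda>x. f x + g x) has_derivative
        (\<lambda>v. frechet_derivative f (at x) v + frechet_derivative g (at x) v)) (at x)"
      if "x \<in> S" for x
      using Suc.prems that by (intro has_derivative_add Ck_on_Suc_derivD)
  qed (use Suc in auto)
qed

lemma Ck_on_sum:
  assumes "open S" "finite B" "\<And>b. b \<in> B \<Longrightarrow> Ck_on n S (f b)"
  shows "Ck_on n S (\<lambda>x. \<Sum>b\<in>B. f b x)"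
  using assms(2,3) by (induction B) (auto simp: Ck_on_const Ck_on_add assms(1))

lemma Ck_on_bilinear:
  fixes f :: "'a::real_normed_vector \<Rightarrow> 'b::real_normed_vector" and g :: "'a \<Rightarrow> 'c::real_normed_vector"
  assumes "open S" and b: "bounded_bilinear m"
  shows "Ck_on n S f \<Longrightarrow> Ck_on n S g \<Longrightarrow> Ck_on n S (\<lambda>x. m (f x) (g x))"
proof (induction n arbitrary: f g)
  case 0
  then show ?case using bounded_bilinear.continuous_on[OF b] by auto
next
  case (Suc n)
  note f = Ck_on_lower[OF Suc.prems(1)] and g = Ck_on_lower[OF Suc.prems(2)]
  show ?case
  proof (rule Ck_on_Suc_derivI[OF assms(1)])
    show "((\<lambda>x. m (f x) (g x)) has_derivative
        (\<lambda>v. m (f x) (frechet_derivative g (at x) v) +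
             m (frechet_derivative f (at x) v) (g x))) (at x)"
      if "x \<in> S" for x
      using Suc.prems that by (intro bounded_bilinear.FDERIV[OF b] Ck_on_Suc_derivD)
    show "Ck_on n S (\<lambda>x. m (f x) (frechet_derivative g (at x) v) +
             m (frechet_derivative f (at x) v) (g x))" for v
      using Suc f g by (intro Ck_on_add assms(1)) auto
  qed
qed

text \<open>The inner derivative is expanded in a basis so that the induction hypothesis applies to the
  directional derivatives of \<open>f\<close> in fixed directions.\<close>

lemma Ck_on_compose:
  fixes g :: "'a::real_normed_vector \<Rightarrow> 'b::euclidean_space"
    and f :: "'b \<Rightarrow> 'c::real_normed_vector"
  assumes "open S" "g ` S \<subseteq> T"
  shows "Ck_on n S g \<Longrightarrow> Ck_on n T f \<Longrightarrow> Ck_on n S (\<lambda>x. f (g x))"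
proof (induction n arbitrary: f)
  case 0
  then show ?case using assms by (auto intro: continuous_on_compose2)
next
  case (Suc n)
  note g = Ck_on_lower[OF Suc.prems(1)]
  show ?case
  proof (rule Ck_on_Suc_derivI[OF assms(1)])
    show "((\<lambda>x. f (g x)) has_derivative
        (\<lambda>v. \<Sum>b\<in>Basis. (frechet_derivative g (at x) v \<bullet> b) *\<^sub>R frechet_derivative f (at (g x)) b)) (at x)"
      if "x \<in> S" for x
    proof -
      have G: "(g has_derivative frechet_derivative g (at x)) (at x)"
        using Suc.prems that by (intro Ck_on_Suc_derivD)
      have F: "(f has_derivative frechet_derivative f (at (g x))) (at (g x))"
        using Suc.prems(2) that assms by (intro Ck_on_Suc_derivD) auto
      have "frechet_derivative f (at (g x)) w =
          (\<Sum>b\<in>Basis. (w \<bullet> b) *\<^sub>R frechet_derivative f (at (g x)) b)" for w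
      proof -
        have "frechet_derivative f (at (g x)) (\<Sum>b\<in>Basis. (w \<bullet> b) *\<^sub>R b) =
            (\<Sum>b\<in>Basis. (w \<bullet> b) *\<^sub>R frechet_derivative f (at (g x)) b)"
          using has_derivative_linear[OF F] by (simp only: linear_sum linear_scale)
        then show ?thesis by (simp only: euclidean_representation)
      qed
      then show ?thesis by (intro has_derivative_eq_rhs[OF has_derivative_compose[OF G F]] ext)
    qed
    show "Ck_on n S (\<lambda>x. \<Sum>b\<in>Basis.
        (frechet_derivative g (at x) v \<bullet> b) *\<^sub>R frechet_derivative f (at (g x)) b)" for v
    proof (intro Ck_on_sum assms(1) Ck_on_bilinear[OF assms(1) bounded_bilinear_scaleR]
        Ck_on_bilinear[OF assms(1) bounded_bilinear_inner])
      show "Ck_on n S (\<lambda>x. frechet_derivative f (at (g x)) b)" for b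
        using Suc.IH[OF g, of "\<lambda>y. frechet_derivative f (at y) b"] Suc.prems(2) by simp
    qed (use Suc.prems(1) in \<open>auto intro: Ck_on_const assms(1)\<close>)
  qed
qed

section \<open>Closure properties of smooth maps\<close>

lemma smooth_onD: "smooth_on S f \<Longrightarrow> Ck_on n S f"
  by (simp add: smooth_on_def)

lemma smooth_on_has_derivative:
  "smooth_on S f \<Longrightarrow> x \<in> S \<Longrightarrow> (f has_derivative frechet_derivative f (at x)) (at x)"
  by (rule Ck_on_Suc_derivD[OF smooth_onD])

lemma smooth_on_continuous: "smooth_on S f \<Longrightarrow> continuous_on S f"
  using smooth_onD[of S f 0] by simp

lemma smooth_on_mono: "smooth_on S f \<Longrightarrow> T \<subseteq> S \<Longrightarrow> smooth_on T f"
  by (auto simp: smooth_on_def intro: Ck_on_mono)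

lemma smooth_on_const: "open S \<Longrightarrow> smooth_on S (\<lambda>x. c)"
  by (simp add: smooth_on_def Ck_on_const)

lemma smooth_on_bounded_linear: "open S \<Longrightarrow> bounded_linear h \<Longrightarrow> smooth_on S h"
  by (simp add: smooth_on_def Ck_on_bounded_linear)

lemma smooth_on_compose:
  fixes g :: "'a::real_normed_vector \<Rightarrow> 'b::euclidean_space"
    and f :: "'b \<Rightarrow> 'c::real_normed_vector"
  assumes "open S" "smooth_on S g" "smooth_on T f" "g ` S \<subseteq> T"
  shows "smooth_on S (\<lambda>x. f (g x))"
  unfolding smooth_on_def[of S]
  by (intro allI Ck_on_compose[OF assms(1,4) smooth_onD[OF assms(2)] smooth_onD[OF assms(3)]])

lemma smooth_on_linear_compose:
  fixes g :: "'a::real_normed_vector \<Rightarrow> 'b::euclidean_space"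
  assumes "open S" "bounded_linear h" "smooth_on S g"
  shows "smooth_on S (\<lambda>x. h (g x))"
  by (rule smooth_on_compose[OF assms(1,3) smooth_on_bounded_linear[OF open_UNIV assms(2)]]) simp

lemma smooth_on_add:
  "open S \<Longrightarrow> smooth_on S f \<Longrightarrow> smooth_on S g \<Longrightarrow> smooth_on S (\<lambda>x. f x + g x)"
  by (simp add: smooth_on_def Ck_on_add)

lemma smooth_on_uminus:
  fixes f :: "'a::real_normed_vector \<Rightarrow> 'b::euclidean_space"
  shows "open S \<Longrightarrow> smooth_on S f \<Longrightarrow> smooth_on S (\<lambda>x. - f x)"
  using smooth_on_linear_compose[of S "\<lambda>y. - y" f]
  by (simp add: bounded_linear_minus bounded_linear_ident)

lemma smooth_on_diff:
  fixes f g :: "'a::real_normed_vector \<Rightarrow> 'b::euclidean_space"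
  shows "open S \<Longrightarrow> smooth_on S f \<Longrightarrow> smooth_on S g \<Longrightarrow> smooth_on S (\<lambda>x. f x - g x)"
  using smooth_on_add[of S f "\<lambda>x. - g x"] smooth_on_uminus by auto

lemma smooth_on_mult:
  fixes f g :: "'a::real_normed_vector \<Rightarrow> real"
  shows "open S \<Longrightarrow> smooth_on S f \<Longrightarrow> smooth_on S g \<Longrightarrow> smooth_on S (\<lambda>x. f x * g x)"
  by (simp add: smooth_on_def Ck_on_bilinear[OF _ bounded_bilinear_mult])

text \<open>A pair is the sum of its two components embedded linearly into the product, so
  composition and addition suffice and no further induction arises.\<close>

lemma Ck_on_Pair:
  fixes f :: "'a::real_normed_vector \<Rightarrow> 'b::euclidean_space"
    and g :: "'a \<Rightarrow> 'c::euclidean_space"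
  assumes "open S" "Ck_on n S f" "Ck_on n S g"
  shows "Ck_on n S (\<lambda>x. (f x, g x))"
proof -
  have "Ck_on n S (\<lambda>x. (f x, 0::'c))"
    by (rule Ck_on_compose[where T = UNIV and f = "\<lambda>y. (y, 0::'c)", OF assms(1) _ assms(2)])
      (auto intro!: Ck_on_bounded_linear bounded_linear_Pair bounded_linear_ident bounded_linear_zero)
  moreover have "Ck_on n S (\<lambda>x. (0::'b, g x))"
    by (rule Ck_on_compose[where T = UNIV and f = "\<lambda>y. (0::'b, y)", OF assms(1) _ assms(3)])
      (auto intro!: Ck_on_bounded_linear bounded_linear_Pair bounded_linear_ident bounded_linear_zero)
  ultimately have "Ck_on n S (\<lambda>x. (f x, 0) + (0, g x))"
    by (rule Ck_on_add[OF assms(1)])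
  then show ?thesis by simp
qed

lemma smooth_on_Pair:
  fixes f :: "'a::real_normed_vector \<Rightarrow> 'b::euclidean_space"
    and g :: "'a \<Rightarrow> 'c::euclidean_space"
  shows "open S \<Longrightarrow> smooth_on S f \<Longrightarrow> smooth_on S g \<Longrightarrow> smooth_on S (\<lambda>x. (f x, g x))"
  by (simp add: smooth_on_def Ck_on_Pair)

lemma smooth_on_fst:
  fixes f :: "'a::real_normed_vector \<Rightarrow> 'b::euclidean_space \<times> 'c::euclidean_space"
  shows "open S \<Longrightarrow> smooth_on S f \<Longrightarrow> smooth_on S (\<lambda>x. fst (f x))"
  by (rule smooth_on_linear_compose[OF _ bounded_linear_fst])

lemma smooth_on_snd:
  fixes f :: "'a::real_normed_vector \<Rightarrow> 'b::euclidean_space \<times> 'c::euclidean_space"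
  shows "open S \<Longrightarrow> smooth_on S f \<Longrightarrow> smooth_on S (\<lambda>x. snd (f x))"
  by (rule smooth_on_linear_compose[OF _ bounded_linear_snd])

lemma smooth_on_ident: "open S \<Longrightarrow> smooth_on S (\<lambda>x. x)"
  by (rule smooth_on_bounded_linear[OF _ bounded_linear_ident])

lemmas smooth_on_intros = smooth_on_const smooth_on_ident smooth_on_add smooth_on_uminus
  smooth_on_diff smooth_on_mult smooth_on_Pair smooth_on_fst smooth_on_snd

section \<open>Smooth functions of one real variable\<close>

lemma smooth_on_DERIV:
  fixes f :: "real \<Rightarrow> real"
  assumes "smooth_on S f" "x \<in> S"
  shows "(f has_real_derivative deriv f x) (at x)"
  using assms smooth_onD[of S f "Suc 0"]
  by (simp add: DERIV_deriv_iff_real_differentiable)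

text \<open>\<open>deriv f\<close> is the Frechet derivative in the direction 1, whose regularity is
  part of the definition of \<open>Ck_on\<close>.\<close>

lemma smooth_on_deriv:
  fixes f :: "real \<Rightarrow> real"
  assumes "open S" "smooth_on S f"
  shows "smooth_on S (deriv f)"
proof -
  have "frechet_derivative f (at x) 1 = deriv f x" if "x \<in> S" for x
    using frechet_derivative_at[OF smooth_on_DERIV[OF assms(2) that, unfolded has_field_derivative_def]]
    by (metis mult.right_neutral)
  moreover have "Ck_on n S (\<lambda>x. frechet_derivative f (at x) 1)" for n
    using smooth_onD[OF assms(2), of "Suc n"] by simp
  ultimately show ?thesis
    using Ck_on_cong[OF assms(1), of _ "\<lambda>x. frechet_derivative f (at x) 1" "deriv f"]
    by (simp add: smooth_on_def)
qed

lemma Ck_on_Suc_real: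
  fixes f :: "real \<Rightarrow> real"
  assumes "open S" "\<And>x. x \<in> S \<Longrightarrow> (f has_real_derivative f' x) (at x)" "Ck_on n S f'"
  shows "Ck_on (Suc n) S f"
proof (rule Ck_on_Suc_derivI[OF assms(1)])
  show "(f has_derivative (*) (f' x)) (at x)" if "x \<in> S" for x
    using assms(2)[OF that] by (simp add: has_field_derivative_def)
  show "Ck_on n S (\<lambda>x. f' x * v)" for v
    by (rule Ck_on_bilinear[OF assms(1) bounded_bilinear_mult assms(3) Ck_on_const[OF assms(1)]])
qed

text \<open>Bootstrapping: if \<mu> is of class \<open>n\<close>, so is the right-hand side, hence
  \<mu> is of class \<open>n + 1\<close>. The map \<open>c\<close> gathers all smooth coefficients
  that depend on the time.\<close>

lemma smooth_on_ode_solution: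
  fixes \<mu> :: "real \<Rightarrow> real" and c :: "real \<Rightarrow> 'a::euclidean_space" and F :: "real \<times> 'a \<Rightarrow> real"
  assumes "open J" "smooth_on J c" "smooth_on U F"
    and dom: "\<And>t. t \<in> J \<Longrightarrow> (\<mu> t, c t) \<in> U"
    and ode: "\<And>t. t \<in> J \<Longrightarrow> (\<mu> has_real_derivative F (\<mu> t, c t)) (at t)"
  shows "smooth_on J \<mu>"
proof -
  have "Ck_on n J \<mu>" for n
  proof (induction n)
    case 0
    then show ?case
      using ode by (auto intro!: continuous_at_imp_continuous_on dest: DERIV_isCont)
  next
    case (Suc n)
    have "Ck_on n J (\<lambda>t. F (\<mu> t, c t))"
      by (rule Ck_on_compose[OF assms(1) _ Ck_on_Pair[OF assms(1) Suc smooth_onD[OF assms(2)]]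
            smooth_onD[OF assms(3)]]) (use dom in auto)
    then show ?case using assms(1) ode by (intro Ck_on_Suc_real)
  qed
  then show ?thesis by (simp add: smooth_on_def)
qed

text \<open>An equation valid on \<open>S\<close> holds along every curve in \<open>S\<close>; the
  chain rule at time 0 differentiates it in the direction of the velocity.\<close>

lemma tangent_space_derivative_zero:
  assumes v: "v \<in> tangent_space S P" and h: "(h has_derivative h') (at P)"
    and z: "\<And>Q. Q \<in> S \<Longrightarrow> h Q = 0"
  shows "h' v = 0"
proof -
  obtain \<gamma> \<epsilon> where g: "\<epsilon> > 0" "\<gamma> ` {-\<epsilon><..<\<epsilon>} \<subseteq> S" "\<gamma> 0 = P"
    "(\<gamma> has_vector_derivative v) (at (0::real))"
    using v by (auto simp: tangent_space_def)
  have "((\<lambda>t. h (\<gamma> t)) has_derivative (\<lambda>t. h' (t *\<^sub>R v))) (at 0)"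
    using has_derivative_compose[OF g(4)[unfolded has_vector_derivative_def], of h h'] h g(3) by simp
  moreover have "((\<lambda>t. h (\<gamma> t)) has_derivative (\<lambda>t. 0)) (at 0)"
  proof (rule has_derivative_transform_within_open[OF has_derivative_const, where s = "{-\<epsilon><..<\<epsilon>}"])
    show "0 = h (\<gamma> t)" if "t \<in> {-\<epsilon><..<\<epsilon>}" for t
      using z[of "\<gamma> t"] g(2) that by fastforce
  qed (use g(1) in auto)
  ultimately have "(\<lambda>t. h' (t *\<^sub>R v)) = (\<lambda>t. 0)"
    by (rule has_derivative_unique)
  from fun_cong[OF this, of 1] show ?thesis by simp
qed


section \<open>The generators of the ideal\<close>

abbreviation jx :: "jet \<Rightarrow> real" where "jx P \<equiv> fst P"
abbreviation jy :: "jet \<Rightarrow> real" where "jy P \<equiv> fst (snd P)"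
abbreviation jz :: "jet \<Rightarrow> real" where "jz P \<equiv> fst (snd (snd P))"
abbreviation jp :: "jet \<Rightarrow> real" where "jp P \<equiv> fst (snd (snd (snd P)))"
abbreviation jq :: "jet \<Rightarrow> real" where "jq P \<equiv> snd (snd (snd (snd P)))"

text \<open>A linear map is its own derivative. Dropping one argument from a list of length at least
  2 leaves a nonempty list, on which a form of degree 0 vanishes.\<close>

lemma ext_d_form_of_linear:
  assumes "bounded_linear f"
  shows "ext_d (form_of_fun f) P vs = (if length vs = 1 then f (hd vs) else 0)"
proof (cases "length vs = 1")
  case True
  then obtain v where "vs = [v]" by (auto simp: length_Suc_conv)
  then show ?thesis
    using frechet_derivative_at[OF bounded_linear_imp_has_derivative[OF assms]]
    by (simp add: ext_d_def form_of_fun_def)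
next
  case False
  then have "take i vs @ drop (Suc i) vs \<noteq> []" if "i < length vs" for i
    using that by auto
  then have "form_of_fun f Q (take i vs @ drop (Suc i) vs) = 0" if "i < length vs" for Q i
    using that by (auto simp: form_of_fun_def)
  then show ?thesis using False by (simp add: ext_d_def)
qed

lemma contact_form_eq:
  "contact_form P vs =
     (if length vs = 1 then jz (hd vs) - jp P * jx (hd vs) - jq P * jy (hd vs) else 0)"
  by (cases P) (simp add: contact_form_def d_x_def d_y_def d_z_def ext_d_form_of_linear
      case_prod_unfold bounded_linear_intros)

lemma alpha_form_eq:
  "alpha_form \<alpha> P vs = (if length vs = 1 then jp (hd vs) - \<alpha> P * jq (hd vs) else 0)"
  by (simp add: alpha_form_def d_p_def d_q_def ext_d_form_of_linear
      case_prod_unfold bounded_linear_intros)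

text \<open>On two vectors the exterior derivative of a one-form is the difference of the two sides
  of \<open>d\<close>. On any other number of vectors every summand evaluates \<omega> outside
  degree 1.\<close>

lemma pullback_vanishes_ext_d_one_form:
  assumes z: "\<And>Q us. length us \<noteq> 1 \<Longrightarrow> \<omega> Q us = 0"
    and d: "\<And>P v w. P \<in> S \<Longrightarrow> v \<in> tangent_space S P \<Longrightarrow> w \<in> tangent_space S P \<Longrightarrow>
      frechet_derivative (\<lambda>Q. \<omega> Q [w]) (at P) v = frechet_derivative (\<lambda>Q. \<omega> Q [v]) (at P) w"
  shows "pullback_vanishes S (ext_d \<omega>)"
  unfolding pullback_vanishes_def
proof (intro ballI allI impI)
  fix P vs assume P: "P \<in> S" "set vs \<subseteq> tangent_space S P"
  show "ext_d \<omega> P vs = 0"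
  proof (cases "length vs = 2")
    case True
    then obtain v w where "vs = [v, w]" by (auto simp: numeral_2_eq_2 length_Suc_conv)
    then show ?thesis using d[of P v w] P by (simp add: ext_d_def)
  next
    case False
    then have "\<omega> Q (take i vs @ drop (Suc i) vs) = 0" if "i < length vs" for Q i
      using that by (intro z) auto
    then show ?thesis by (simp add: ext_d_def)
  qed
qed

text \<open>In a wedge product with a member of the ideal, each summand evaluates that member on a
  sublist of the tangent vectors and so contains a zero factor.\<close>

lemma diff_ideal_pullback_vanishes:
  assumes "\<omega> \<in> diff_ideal M G"
    and "\<And>\<omega>. \<omega> \<in> G \<Longrightarrow> pullback_vanishes S \<omega> \<and> pullback_vanishes S (ext_d \<omega>)"
  shows "pullback_vanishes S \<omega>"
  using assms(1)
proof induction
  case (wedge_left \<eta> \<omega>)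
  then have "\<omega> P (nths vs X) = 0" if "P \<in> S" "set vs \<subseteq> tangent_space S P" for P vs X
    using that set_nths_subset[of vs X] unfolding pullback_vanishes_def by blast
  then show ?case by (simp add: pullback_vanishes_def wedge_def)
next
  case (wedge_right \<omega> \<eta>)
  then have "\<omega> P (nths vs X) = 0" if "P \<in> S" "set vs \<subseteq> tangent_space S P" for P vs X
    using that set_nths_subset[of vs X] unfolding pullback_vanishes_def by blast
  then show ?case by (simp add: pullback_vanishes_def wedge_def)
qed (use assms(2) in \<open>auto simp: pullback_vanishes_def\<close>)

text \<open>Differentiating the four equations along \<open>S\<close> gives all relations between tangent vectors that
  are needed; the last equation encodes the differential equation for \<open>\<mu>\<close>, since the left-hand side
  is \<open>\<beta> + \<mu>'\<close>.\<close>

lemma system_ideal_pullback_vanishes: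
  assumes \<alpha>: "smooth_on M \<alpha>" and SM: "S \<subseteq> M"
    and \<xi>: "open J" "smooth_on J \<xi>" and \<mu>: "smooth_on J \<mu>"
    and J: "\<And>P. P \<in> S \<Longrightarrow> jq P \<in> J"
    and p: "\<And>P. P \<in> S \<Longrightarrow> jp P - \<xi> (jq P) = 0"
    and a: "\<And>P. P \<in> S \<Longrightarrow> \<alpha> P - deriv \<xi> (jq P) = 0"
    and z: "\<And>P. P \<in> S \<Longrightarrow> jz P - jp P * jx P - jq P * jy P - \<mu> (jq P) = 0"
    and b: "\<And>P. P \<in> S \<Longrightarrow> jy P + deriv \<xi> (jq P) * jx P + deriv \<mu> (jq P) = 0"
    and \<omega>: "\<omega> \<in> system_ideal M \<alpha>"
  shows "pullback_vanishes S \<omega>"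
proof -
  define \<alpha>' where "\<alpha>' P = frechet_derivative \<alpha> (at P)" for P
  have \<alpha>': "(\<alpha> has_derivative \<alpha>' P) (at P)" if "P \<in> S" for P
    unfolding \<alpha>'_def using smooth_on_has_derivative[OF \<alpha>] SM that by blast
  have q: "((\<lambda>Q::jet. f (jq Q)) has_derivative (\<lambda>v. jq v * deriv f (jq P))) (at P)"
    if "smooth_on J f" "P \<in> S" for f :: "real \<Rightarrow> real" and P
    using smooth_on_DERIV[OF that(1) J[OF that(2)]] bounded_linear_imp_has_derivative
    by (rule DERIV_compose_FDERIV) (simp add: bounded_linear_intros)
  note \<xi>' = smooth_on_deriv[OF \<xi>] and \<mu>' = smooth_on_deriv[OF \<xi>(1) \<mu>]
  have T:
    "jp v = \<alpha> P * jq v"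
    "\<alpha>' P v = deriv (deriv \<xi>) (jq P) * jq v"
    "jz v = jp P * jx v + jq P * jy v"
    "jy v + \<alpha> P * jx v = - (deriv (deriv \<xi>) (jq P) * jx P + deriv (deriv \<mu>) (jq P)) * jq v"
    if P: "P \<in> S" and v: "v \<in> tangent_space S P" for P v
  proof -
    note [derivative_intros] = q[OF \<xi>(2) P] q[OF \<mu> P] q[OF \<xi>' P] q[OF \<mu>' P] \<alpha>'[OF P]
    have 1: "jp v - jq v * deriv \<xi> (jq P) = 0"
      by (rule tangent_space_derivative_zero[OF v _ p]) (auto intro!: derivative_eq_intros)
    have 2: "\<alpha>' P v - jq v * deriv (deriv \<xi>) (jq P) = 0"
      by (rule tangent_space_derivative_zero[OF v _ a]) (auto intro!: derivative_eq_intros)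
    have 3: "jz v - (jp P * jx v + jp v * jx P) - (jq P * jy v + jq v * jy P)
        - jq v * deriv \<mu> (jq P) = 0"
      by (rule tangent_space_derivative_zero[OF v _ z]) (auto intro!: derivative_eq_intros)
    have 4: "jy v + (deriv \<xi> (jq P) * jx v + jq v * deriv (deriv \<xi>) (jq P) * jx P)
        + jq v * deriv (deriv \<mu>) (jq P) = 0"
      by (rule tangent_space_derivative_zero[OF v _ b]) (auto intro!: derivative_eq_intros)
    show "jp v = \<alpha> P * jq v" using 1 a[OF P] by simp
    show "\<alpha>' P v = deriv (deriv \<xi>) (jq P) * jq v" using 2 by simp
    \<comment> \<open>This is what remains of relation 3 once the contact form is split off and
      \<open>jp v\<close> is replaced by means of relation 1; here the differential equation for
      \<mu> enters.\<close>
    have "jq v * (jy P + deriv \<xi> (jq P) * jx P + deriv \<mu> (jq P)) = 0" using b[OF P] by simp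
    then show "jz v = jp P * jx v + jq P * jy v" using 1 3 by (simp add: algebra_simps)
    show "jy v + \<alpha> P * jx v
        = - (deriv (deriv \<xi>) (jq P) * jx P + deriv (deriv \<mu>) (jq P)) * jq v"
      using 4 a[OF P] by (simp add: algebra_simps)
  qed
  have hd: "hd vs \<in> tangent_space S P"
    if "set vs \<subseteq> tangent_space S P" "length vs = 1" for vs P
    using that by (cases vs) auto
  have "pullback_vanishes S (ext_d contact_form)"
  proof (rule pullback_vanishes_ext_d_one_form)
    \<comment> \<open>For a fixed argument \<open>w\<close>, only the coefficients \<open>p\<close>
      and \<open>q\<close> vary with the base point.\<close>
    have D: "frechet_derivative (\<lambda>Q. contact_form Q [w]) (at P)
        = (\<lambda>v. - (jp v * jx w) - jq v * jy w)" for P w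
      unfolding contact_form_eq
      by (rule frechet_derivative_at[symmetric]) (auto intro!: derivative_eq_intros)
    fix P v w assume P: "P \<in> S" and v: "v \<in> tangent_space S P" and w: "w \<in> tangent_space S P"
    \<comment> \<open>Since \<open>dp = \<alpha> dq\<close> on tangent vectors, the exterior
      derivative restricts to the wedge of \<open>dy + \<alpha> dx\<close> with \<open>dq\<close>,
      and the first factor is itself a multiple of \<open>dq\<close> there.\<close>
    have "jq v * (jy w + \<alpha> P * jx w) = jq w * (jy v + \<alpha> P * jx v)"
      using T(4)[OF P v] T(4)[OF P w] by simp
    then show "frechet_derivative (\<lambda>Q. contact_form Q [w]) (at P) v
        = frechet_derivative (\<lambda>Q. contact_form Q [v]) (at P) w"
      unfolding D using T(1)[OF P v] T(1)[OF P w] by (simp add: algebra_simps)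
  qed (simp add: contact_form_eq)
  moreover have "pullback_vanishes S (ext_d (alpha_form \<alpha>))"
  proof (rule pullback_vanishes_ext_d_one_form)
    \<comment> \<open>The exterior derivative is minus the wedge of \<open>d\<alpha>\<close> and
      \<open>dq\<close>; on tangent vectors \<open>d\<alpha>\<close> is a multiple of
      \<open>dq\<close>.\<close>
    have D: "frechet_derivative (\<lambda>Q. alpha_form \<alpha> Q [w]) (at P) = (\<lambda>v. - (\<alpha>' P v * jq w))"
      if "P \<in> S" for P w
      unfolding alpha_form_eq using \<alpha>'[OF that]
      by (intro frechet_derivative_at[symmetric]) (auto intro!: derivative_eq_intros)
    show "frechet_derivative (\<lambda>Q. alpha_form \<alpha> Q [w]) (at P) v
        = frechet_derivative (\<lambda>Q. alpha_form \<alpha> Q [v]) (at P) w"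
      if "P \<in> S" "v \<in> tangent_space S P" "w \<in> tangent_space S P" for P v w
      using T(2)[OF that(1,2)] T(2)[OF that(1,3)] by (simp add: D[OF that(1)])
  qed (simp add: alpha_form_eq)
  moreover have "pullback_vanishes S contact_form"
    by (simp add: pullback_vanishes_def contact_form_eq T(3)[OF _ hd])
  moreover have "pullback_vanishes S (alpha_form \<alpha>)"
    by (simp add: pullback_vanishes_def alpha_form_eq T(1)[OF _ hd])
  ultimately show ?thesis
    using diff_ideal_pullback_vanishes[OF \<omega>[unfolded system_ideal_def]] by blast
qed


section \<open>Independence of the first coordinate\<close>

text \<open>The vector is the velocity of a curve parametrised by \<open>x\<close> on which
  \<open>p\<close>, \<open>q\<close> and \<open>z - p x - q y\<close> are constant, with
  \<open>c = dy/dx\<close>. Involutivity turns the derivative of \<alpha> along it into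
  \<open>(c + \<alpha>) (\<alpha>_y + q \<alpha>_z)\<close>, and non-genericity makes the second
  factor nonzero.\<close>

lemma non_generic_involutive_derivative:
  assumes \<alpha>: "smooth_on M \<alpha>" and M: "P \<in> M"
    and inv: "involutive_type M \<alpha>" and non: "non_generic_type M \<alpha>"
    and D: "frechet_derivative \<alpha> (at P) (1, c, jp P + jq P * c, 0, 0) = 0"
  shows "c = - \<alpha> P"
proof -
  obtain x y z p q where P: "P = (x, y, z, p, q)" by (metis prod_cases5)
  define L where "L = frechet_derivative \<alpha> (at P)"
  have L: "(\<alpha> has_derivative L) (at P)"
    unfolding L_def using smooth_on_has_derivative[OF \<alpha> M] .
  \<comment> \<open>Rewrites the one-variable derivatives from the two type conditions as values of
    the total derivative on coordinate vectors, so that linearity can be used.\<close>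
  have chain: "deriv (\<lambda>s. \<alpha> (g s)) t = L g'"
    if "(g has_vector_derivative g') (at t)" "g t = P" for g g' t
  proof -
    have "((\<lambda>s. \<alpha> (g s)) has_derivative (\<lambda>h. L (h *\<^sub>R g'))) (at t)"
      using has_derivative_compose[OF that(1)[unfolded has_vector_derivative_def]] L that(2) by auto
    moreover have "L (h *\<^sub>R g') = L g' * h" for h
      using linear_scale[OF has_derivative_linear[OF L]] by simp
    ultimately show ?thesis
      by (intro DERIV_imp_deriv) (simp add: has_field_derivative_def)
  qed
  have dx: "deriv (\<lambda>s. \<alpha> (s, y, z, p, q)) x = L (1, 0, 0, 0, 0)"
    by (rule chain) (auto simp: P zero_prod_def intro!: derivative_eq_intros)
  have dy: "deriv (\<lambda>s. \<alpha> (x, s, z, p, q)) y = L (0, 1, 0, 0, 0)"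
    by (rule chain) (auto simp: P zero_prod_def intro!: derivative_eq_intros)
  have dz: "deriv (\<lambda>s. \<alpha> (x, y, s, p, q)) z = L (0, 0, 1, 0, 0)"
    by (rule chain) (auto simp: P zero_prod_def intro!: derivative_eq_intros)
  have e: "(1, c, p + q * c, 0, 0) = (1, 0, 0, 0, 0) + c *\<^sub>R (0, 1, 0, 0, 0)
      + (p + q * c) *\<^sub>R ((0, 0, 1, 0, 0) :: jet)" by simp
  have "L (1, c, p + q * c, 0, 0) =
      L (1, 0, 0, 0, 0) + c * L (0, 1, 0, 0, 0) + (p + q * c) * L (0, 0, 1, 0, 0)"
    unfolding e using has_derivative_linear[OF L] by (simp only: linear_add linear_scale real_scaleR_def)
  moreover have "L (1, 0, 0, 0, 0) + p * L (0, 0, 1, 0, 0)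
      - \<alpha> P * (L (0, 1, 0, 0, 0) + q * L (0, 0, 1, 0, 0)) = 0"
    using inv M P dx dy dz unfolding involutive_type_def by auto
  moreover have n: "1 + x * (L (0, 1, 0, 0, 0) + q * L (0, 0, 1, 0, 0)) = 0"
    using non M P dy dz unfolding non_generic_type_def by auto
  ultimately have "(c + \<alpha> P) * (L (0, 1, 0, 0, 0) + q * L (0, 0, 1, 0, 0)) = 0"
    using D by (simp add: P L_def[unfolded P, symmetric] algebra_simps)
  then show ?thesis using n by (auto simp: add_eq_0_iff2)
qed

lemma Phi2_eq: "Phi2 \<alpha> P = (jx P, \<alpha> P, jz P - jp P * jx P - jq P * jy P, jp P, jq P)"
  by (cases P) (simp add: Phi2_def)

lemma beta_eq: "beta \<alpha> P = jy P + \<alpha> P * jx P"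
  by (cases P) (simp add: beta_def)

text \<open>For fixed \<open>u\<close> the curve \<open>r \<mapsto> \<Psi> (r, u)\<close> satisfies
  the conditions of the preceding derivative computation, so \<open>y\<close> has slope
  \<open>-x1\<close> along it. There \<beta> equals \<open>y + x1 * r\<close>, which has derivative
  zero on an interval.\<close>

lemma beta_independent:
  assumes \<alpha>: "smooth_on M \<alpha>" and inv: "involutive_type M \<alpha>" and non: "non_generic_type M \<alpha>"
    and A: "open_interval A" and \<Psi>: "smooth_on (A \<times> U) \<Psi>"
    and maps: "\<And>v. v \<in> A \<times> U \<Longrightarrow> \<Psi> v \<in> M \<and> Phi2 \<alpha> (\<Psi> v) = v"
    and u: "u \<in> U" and s: "s \<in> A" "s' \<in> A"
  shows "beta \<alpha> (\<Psi> (s, u)) = beta \<alpha> (\<Psi> (s', u))"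
proof -
  obtain x1 x2 x3 x4 where u4: "u = (x1, x2, x3, x4)" by (metis prod_cases4)
  have E: "jx (\<Psi> (r, u)) = r" "\<alpha> (\<Psi> (r, u)) = x1"
    "jz (\<Psi> (r, u)) = x2 + x3 * r + x4 * jy (\<Psi> (r, u))"
    "jp (\<Psi> (r, u)) = x3" "jq (\<Psi> (r, u)) = x4" if "r \<in> A" for r
    using maps[of "(r, u)"] that u by (auto simp: Phi2_eq u4)
  have dphi: "((\<lambda>r. jy (\<Psi> (r, u))) has_real_derivative - x1) (at r)" if r: "r \<in> A" for r
  proof -
    define w where "w = frechet_derivative \<Psi> (at (r, u)) (1, 0)"
    have p: "(\<Psi> has_derivative frechet_derivative \<Psi> (at (r, u))) (at (r, u))"
      by (rule smooth_on_has_derivative[OF \<Psi>]) (use r u in simp)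
    have "((\<lambda>r. (r, u)) has_derivative (\<lambda>h. (h, 0))) (at r)"
      by (auto intro!: derivative_eq_intros)
    from has_derivative_compose[OF this p]
    have "((\<lambda>r. \<Psi> (r, u)) has_derivative (\<lambda>h. frechet_derivative \<Psi> (at (r, u)) (h, 0))) (at r)" .
    moreover have "frechet_derivative \<Psi> (at (r, u)) (h, 0) = h *\<^sub>R w" for h
      using linear_scale[OF has_derivative_linear[OF p], of h "(1, 0)"] by (simp add: w_def)
    ultimately have D: "((\<lambda>r. \<Psi> (r, u)) has_derivative (\<lambda>h. h *\<^sub>R w)) (at r)" by simp
    \<comment> \<open>A function that is affine in \<open>r\<close> along the curve has its slope as
      derivative in the direction \<open>w\<close>. Applied to coordinates, this determines
      \<open>w\<close> up to its \<open>y\<close>-component; applied to \<alpha>, it gives the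
      derivative zero.\<close>
    have eq: "k w = k'"
      if k: "(K has_derivative k) (at (\<Psi> (r, u)))" and c: "\<And>r. r \<in> A \<Longrightarrow> K (\<Psi> (r, u)) = c + k' * r"
      for K :: "jet \<Rightarrow> real" and k k' c
    proof -
      have "((\<lambda>r. c + k' * r) has_derivative (\<lambda>h. k' * h)) (at r)"
        by (auto intro!: derivative_eq_intros)
      then have "((\<lambda>r. K (\<Psi> (r, u))) has_derivative (\<lambda>h. k' * h)) (at r)"
        using A r c by (elim has_derivative_transform_within_open[where s = A])
          (simp_all add: open_interval_def)
      with has_derivative_compose[OF D k] have "(\<lambda>h. k (h *\<^sub>R w)) = (\<lambda>h. k' * h)"
        by (rule has_derivative_unique)
      from fun_cong[OF this, of 1] show ?thesis by simp
    qed
    note lin = eq[OF bounded_linear_imp_has_derivative]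
    have "jx w = 1"
      by (rule lin[where c = 0]) (simp_all add: E bounded_linear_intros)
    moreover have "jp w = 0"
      by (rule lin[where c = x3]) (simp_all add: E bounded_linear_intros)
    moreover have "jq w = 0"
      by (rule lin[where c = x4]) (simp_all add: E bounded_linear_intros)
    moreover have "jz w - x4 * jy w = x3"
      by (rule lin[where c = x2 and K = "\<lambda>P. jz P - x4 * jy P"]) (simp_all add: E bounded_linear_intros)
    ultimately have w: "w = (1, jy w, x3 + x4 * jy w, 0, 0)"
      by (simp add: prod_eq_iff)
    have M: "\<Psi> (r, u) \<in> M" using maps[of "(r, u)"] r u by simp
    have "frechet_derivative \<alpha> (at (\<Psi> (r, u))) w = 0"
      by (rule eq[OF smooth_on_has_derivative[OF \<alpha> M], of x1]) (simp add: E)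
    then have "jy w = - x1"
      using non_generic_involutive_derivative[OF \<alpha> M inv non, of "jy w"] by (simp add: E[OF r] flip: w)
    then have "(\<lambda>h. jy (h *\<^sub>R w)) = (*) (- x1)" by (simp add: fun_eq_iff)
    moreover have "((\<lambda>r. jy (\<Psi> (r, u))) has_derivative (\<lambda>h. jy (h *\<^sub>R w))) (at r)"
      using bounded_linear.has_derivative[OF _ D, of jy] by (simp add: bounded_linear_intros)
    ultimately show ?thesis by (simp only: has_field_derivative_def)
  qed
  have "((\<lambda>r. jy (\<Psi> (r, u)) + x1 * r) has_real_derivative 0) (at r within A)" if "r \<in> A" for r
    using DERIV_add[OF dphi[OF that] DERIV_cmult_Id[of x1]]
    by (auto intro: has_field_derivative_at_within)
  moreover have "convex A"
    using A by (simp add: open_interval_def is_interval_convex)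
  ultimately obtain c where "\<And>r. r \<in> A \<Longrightarrow> jy (\<Psi> (r, u)) + x1 * r = c"
    using has_field_derivative_zero_constant[of A "\<lambda>r. jy (\<Psi> (r, u)) + x1 * r"] by blast
  then have "beta \<alpha> (\<Psi> (r, u)) = c" if "r \<in> A" for r
    using that by (simp add: beta_eq E)
  then show ?thesis using s by simp
qed

text \<open>The point \<open>a\<close> makes the description definite: over an empty
  \<open>A\<close> every number would satisfy the defining condition.\<close>

lemma beta_bar_eq:
  assumes "\<And>s s'. s \<in> A \<Longrightarrow> s' \<in> A \<Longrightarrow> beta \<alpha> (\<Psi> (s, u)) = beta \<alpha> (\<Psi> (s', u))" and "a \<in> A"
  shows "beta_bar A \<alpha> \<Psi> u = beta \<alpha> (\<Psi> (a, u))"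
  unfolding beta_bar_def
proof (rule the_equality)
  show "\<forall>s\<in>A. beta \<alpha> (\<Psi> (s, u)) = beta \<alpha> (\<Psi> (a, u))" using assms by blast
  show "b = beta \<alpha> (\<Psi> (a, u))" if "\<forall>s\<in>A. beta \<alpha> (\<Psi> (s, u)) = b" for b
    using that assms(2) by simp
qed


section \<open>The surface as a submanifold\<close>

lemma diffeomorphismI:
  assumes "open U" "open V" "smooth_on U f" "smooth_on V g"
    and "\<And>u. u \<in> U \<Longrightarrow> f u \<in> V \<and> g (f u) = u" "\<And>v. v \<in> V \<Longrightarrow> g v \<in> U \<and> f (g v) = v"
  shows "diffeomorphism U V f g"
proof -
  have "f ` U \<subseteq> V" "g ` V \<subseteq> U" using assms(5,6) by blast+
  moreover have "V \<subseteq> f ` U" "U \<subseteq> g ` V" using assms(5,6) by (metis imageI subsetI)+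
  ultimately have "f ` U = V" "g ` V = U" by blast+
  then show ?thesis using assms by (simp add: diffeomorphism_def)
qed

text \<open>The image of the first map need not match the domain of the second, so both ends are cut
  down to preimages, which are open by continuity.\<close>

lemma diffeomorphism_compose:
  fixes f1 :: "'a::euclidean_space \<Rightarrow> 'b::euclidean_space" and f2 :: "'b \<Rightarrow> 'c::euclidean_space"
  assumes 1: "diffeomorphism U1 V1 f1 g1" and 2: "diffeomorphism U2 V2 f2 g2"
  shows "diffeomorphism (U1 \<inter> f1 -` U2) (V2 \<inter> g2 -` V1) (\<lambda>x. f2 (f1 x)) (\<lambda>y. g1 (g2 y))"
proof -
  note d = 1[unfolded diffeomorphism_def] 2[unfolded diffeomorphism_def]
  have m1: "\<And>u. u \<in> U1 \<Longrightarrow> f1 u \<in> V1 \<and> g1 (f1 u) = u" "\<And>v. v \<in> V1 \<Longrightarrow> g1 v \<in> U1 \<and> f1 (g1 v) = v"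
    using d(1) by blast+
  have m2: "\<And>u. u \<in> U2 \<Longrightarrow> f2 u \<in> V2 \<and> g2 (f2 u) = u" "\<And>v. v \<in> V2 \<Longrightarrow> g2 v \<in> U2 \<and> f2 (g2 v) = v"
    using d(2) by blast+
  have s: "open U1" "open V2" "open U2" "open V1" "smooth_on U1 f1" "smooth_on V1 g1" "smooth_on U2 f2" "smooth_on V2 g2"
    using d by blast+
  have o: "open (U1 \<inter> f1 -` U2)" "open (V2 \<inter> g2 -` V1)"
    using s by (simp_all add: continuous_open_preimage smooth_on_continuous)
  show ?thesis
  proof (rule diffeomorphismI[OF o])
    show "smooth_on (U1 \<inter> f1 -` U2) (\<lambda>x. f2 (f1 x))"
      by (rule smooth_on_compose[OF o(1) smooth_on_mono[OF s(5)] s(7)]) auto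
    show "smooth_on (V2 \<inter> g2 -` V1) (\<lambda>y. g1 (g2 y))"
      by (rule smooth_on_compose[OF o(2) smooth_on_mono[OF s(8)] s(6)]) auto
  qed (use m1 m2 in simp_all)
qed

text \<open>Carries the plane \<open>y = z = p = 0\<close> onto the graph of
  \<open>(a, b, c)\<close> over the \<open>(x, q)\<close>-plane; negating the three functions gives
  the inverse map.\<close>

definition shear :: "(real \<Rightarrow> real) \<Rightarrow> (real \<Rightarrow> real) \<Rightarrow> (real \<Rightarrow> real) \<Rightarrow> jet \<Rightarrow> jet" where
  "shear a b c v = (jx v, jy v + a (jq v), jz v + b (jq v), jp v + c (jq v), jq v)"

lemma smooth_on_shear:
  assumes "open I" "open J" "smooth_on J a" "smooth_on J b" "smooth_on J c"
  shows "smooth_on {v. jx v \<in> I \<and> jq v \<in> J} (shear a b c)" (is "smooth_on ?D _")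
    and "open {v. jx v \<in> I \<and> jq v \<in> J}"
proof -
  have "?D = I \<times> UNIV \<times> UNIV \<times> UNIV \<times> J" by auto
  then show o: "open ?D" using assms by (auto intro!: open_Times)
  have q: "smooth_on ?D (\<lambda>v::jet. f (jq v))" if "smooth_on J f" for f :: "real \<Rightarrow> real"
  proof (rule smooth_on_compose[OF o _ that])
    show "smooth_on ?D jq" by (intro smooth_on_intros o)
  qed auto
  show "smooth_on ?D (shear a b c)"
    unfolding shear_def by (intro smooth_on_intros o q assms(3-5))
qed

lemma diffeomorphism_shear:
  assumes "open I" "open J" "smooth_on J a" "smooth_on J b" "smooth_on J c"
  shows "diffeomorphism {v. jx v \<in> I \<and> jq v \<in> J} {v. jx v \<in> I \<and> jq v \<in> J}
    (shear (\<lambda>t. - a t) (\<lambda>t. - b t) (\<lambda>t. - c t)) (shear a b c)"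
proof (rule diffeomorphismI)
  show "smooth_on {v. jx v \<in> I \<and> jq v \<in> J} (shear (\<lambda>t. - a t) (\<lambda>t. - b t) (\<lambda>t. - c t))"
    using assms by (intro smooth_on_shear(1) smooth_on_uminus)
qed (use smooth_on_shear[OF assms] in \<open>simp_all add: shear_def\<close>)

lemma dim_slice:
  fixes L :: "jet set"
  defines "L \<equiv> {v. jy v = 0 \<and> jz v = 0 \<and> jp v = 0}"
  shows "subspace L" "dim L = 2"
proof -
  show sub: "subspace L" by (auto simp: L_def subspace_def)
  define B where "B = {(1, 0, 0, 0, 0), (0, 0, 0, 0, 1) :: jet}"
  have "independent B"
  proof (rule pairwise_orthogonal_independent)
    show "pairwise orthogonal B" by (auto simp: B_def pairwise_def orthogonal_def)
  qed (auto simp: B_def zero_prod_def)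
  moreover have "B \<subseteq> L" by (auto simp: B_def L_def)
  moreover have "L \<subseteq> span B"
  proof
    fix v assume "v \<in> L"
    then have "v = jx v *\<^sub>R (1, 0, 0, 0, 0) + jq v *\<^sub>R (0, 0, 0, 0, 1)"
      by (simp add: L_def prod_eq_iff)
    also have "\<dots> \<in> span B"
      by (intro span_add span_scale span_base) (auto simp: B_def)
    finally show "v \<in> span B" .
  qed
  moreover have "card B = 2" by (simp add: B_def)
  ultimately show "dim L = 2" using dim_unique[of B L] by auto
qed

text \<open>The chart is \<Phi> followed by the inverse shear, which flattens the graph. The whole
  surface lies in its domain \<open>U\<close>, so this one chart serves at every point.\<close>

lemma submanifold_of_graph:
  fixes W V M :: "jet set" and I J :: "real set" and a b c :: "real \<Rightarrow> real"
  assumes d: "diffeomorphism W V \<Phi> \<Psi>" and "W \<subseteq> M"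
    and I: "open I" and J: "open J" and a: "smooth_on J a" and b: "smooth_on J b" and c: "smooth_on J c"
    and V: "\<And>s t. s \<in> I \<Longrightarrow> t \<in> J \<Longrightarrow> (s, a t, b t, c t, t) \<in> V"
  shows "submanifold 2 M {\<Psi> (s, a t, b t, c t, t) | s t. s \<in> I \<and> t \<in> J}" (is "submanifold 2 M ?S")
proof -
  define D where "D = {v. jx v \<in> I \<and> jq v \<in> J}"
  define L where "L = {v::jet. jy v = 0 \<and> jz v = 0 \<and> jp v = 0}"
  define k where "k = shear (\<lambda>t. - a t) (\<lambda>t. - b t) (\<lambda>t. - c t)"
  define U where "U = W \<inter> \<Phi> -` D"
  define Z where "Z = D \<inter> shear a b c -` V"
  have inv: "\<Psi> v \<in> W" "\<Phi> (\<Psi> v) = v" if "v \<in> V" for v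
    using d that unfolding diffeomorphism_def by blast+
  have dif: "diffeomorphism U Z (\<lambda>P. k (\<Phi> P)) (\<lambda>v. \<Psi> (shear a b c v))"
    unfolding U_def Z_def k_def D_def
    by (intro diffeomorphism_compose[OF d] diffeomorphism_shear I J a b c)
  have SU: "?S \<subseteq> U" using inv V by (auto simp: U_def D_def)
  have kS: "k (\<Phi> (\<Psi> (s, a t, b t, c t, t))) = (s, 0, 0, 0, t)" if "s \<in> I" "t \<in> J" for s t
    using inv V[OF that] by (simp add: k_def shear_def)
  have "(\<lambda>P. k (\<Phi> P)) ` ?S = L \<inter> Z"
  proof (intro equalityI subsetI)
    fix v assume "v \<in> (\<lambda>P. k (\<Phi> P)) ` ?S"
    then show "v \<in> L \<inter> Z" using kS V by (auto simp: L_def Z_def D_def shear_def)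
  next
    fix v assume "v \<in> L \<inter> Z"
    then have "v = k (\<Phi> (\<Psi> (jx v, a (jq v), b (jq v), c (jq v), jq v)))" "jx v \<in> I" "jq v \<in> J"
      using kS[of "jx v" "jq v"] by (auto simp: L_def Z_def D_def prod_eq_iff)
    then show "v \<in> (\<lambda>P. k (\<Phi> P)) ` ?S" by blast
  qed
  moreover have "?S \<inter> U = ?S" using SU by auto
  moreover have "?S \<subseteq> M" using SU assms(2) by (auto simp: U_def)
  ultimately show ?thesis
    unfolding submanifold_def using dif dim_slice[folded L_def] SU by (smt (verit) subsetD)
qed

theorem proposition6p28:
  fixes \<alpha> :: "jet \<Rightarrow> real" and M :: "jet set"
    and \<Psi> :: "jet \<Rightarrow> jet" and A :: "real set" and U2 :: "(real \<times> real \<times> real \<times> real) set"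
    and \<xi> \<mu> :: "real \<Rightarrow> real" and J :: "real set"
  assumes "open M" and "smooth_on M \<alpha>"
    and "involutive_type M \<alpha>" and "non_generic_type M \<alpha>"
    and "open_interval A" and "open U2"
    and "local_inverse M (Phi2 \<alpha>) (A \<times> U2) \<Psi>"
    and "open_interval J" and "smooth_on J \<xi>"
    and "solves_ode J U2 (beta_bar A \<alpha> \<Psi>) \<xi> \<mu>"
  shows "(\<exists>I2 J2. admissible_intervals (A \<times> U2) J \<xi> \<mu> I2 J2) \<and>
    (\<forall>I2 J2. admissible_intervals (A \<times> U2) J \<xi> \<mu> I2 J2 \<longrightarrow>
       integral_manifold 2 M (system_ideal M \<alpha>) (S2 \<Psi> \<xi> \<mu> I2 J2))"
proof -
  note \<alpha> = assms(2)
  obtain W where WM: "W \<subseteq> M" and dif: "diffeomorphism W (A \<times> U2) (Phi2 \<alpha>) \<Psi>"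
    using assms(7) by (auto simp: local_inverse_def)
  note dif' = dif[unfolded diffeomorphism_def]
  have maps: "\<Psi> v \<in> M \<and> Phi2 \<alpha> (\<Psi> v) = v" if "v \<in> A \<times> U2" for v
    using dif' that WM by blast
  have \<Psi>: "smooth_on (A \<times> U2) \<Psi>" and AU: "open (A \<times> U2)" using dif' by blast+
  have opJ: "open J" using assms(8) by (simp add: open_interval_def)
  obtain a where a: "a \<in> A" using assms(5) by (auto simp: open_interval_def)
  have bbar: "beta_bar A \<alpha> \<Psi> u = beta \<alpha> (\<Psi> (s, u))" if "u \<in> U2" "s \<in> A" for u s
    using beta_independent[OF \<alpha> assms(3-5) \<Psi> maps that(1)] that(2) by (intro beta_bar_eq) blast
  note \<xi>' = smooth_on_deriv[OF opJ assms(9)]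
  have ode: "(deriv \<xi> t, \<mu> t, \<xi> t, t) \<in> U2" "\<mu> differentiable at t"
    "deriv \<mu> t = - beta_bar A \<alpha> \<Psi> (deriv \<xi> t, \<mu> t, \<xi> t, t)" if "t \<in> J" for t
    using assms(10) that by (simp_all add: solves_ode_def eq_neg_iff_add_eq_0)

  have \<mu>: "smooth_on J \<mu>"
  proof (rule smooth_on_ode_solution[OF opJ])
    \<comment> \<open>Freezes the first coordinate at \<open>a\<close>, a harmless choice by
      independence, and moves the unknown \<mu> to the front, where the regularity lemma expects
      it.\<close>
    define \<sigma> :: "real \<times> real \<times> real \<times> real \<Rightarrow> jet"
      where "\<sigma> w = (a, fst (snd w), fst w, snd (snd w))" for w
    have \<sigma>: "smooth_on S \<sigma>" if "open S" for S
      unfolding \<sigma>_def by (intro smooth_on_intros that)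
    have op: "open (\<sigma> -` (A \<times> U2))"
      by (rule open_vimage[OF AU smooth_on_continuous[OF \<sigma>[OF open_UNIV]]])
    have "smooth_on M (\<lambda>P. beta \<alpha> P)"
      unfolding beta_eq by (intro smooth_on_intros assms(1) \<alpha>)
    then have "smooth_on (A \<times> U2) (\<lambda>v. beta \<alpha> (\<Psi> v))"
      by (rule smooth_on_compose[OF AU \<Psi>]) (use maps in blast)
    from smooth_on_compose[OF op \<sigma>[OF op] this]
    show "smooth_on (\<sigma> -` (A \<times> U2)) (\<lambda>w. - beta \<alpha> (\<Psi> (\<sigma> w)))"
      by (intro smooth_on_uminus op) blast
    show "smooth_on J (\<lambda>t. (deriv \<xi> t, \<xi> t, t))"
      by (intro smooth_on_intros opJ \<xi>' assms(9))
    show "(\<mu> t, deriv \<xi> t, \<xi> t, t) \<in> \<sigma> -` (A \<times> U2)" if "t \<in> J" for t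
      using ode[OF that] a by (simp add: \<sigma>_def)
    show "(\<mu> has_real_derivative - beta \<alpha> (\<Psi> (\<sigma> (\<mu> t, deriv \<xi> t, \<xi> t, t)))) (at t)"
      if "t \<in> J" for t
      using ode[OF that] bbar[OF ode(1)[OF that] a]
      by (simp add: \<sigma>_def flip: DERIV_deriv_iff_real_differentiable)
  qed

  \<comment> \<open>A solution stays in \<open>U2\<close> for all times in \<open>J\<close>, so the
    full intervals already qualify.\<close>
  have "admissible_intervals (A \<times> U2) J \<xi> \<mu> A J"
    using assms(5,8) ode(1) by (simp add: admissible_intervals_def)
  moreover have "integral_manifold 2 M (system_ideal M \<alpha>) (S2 \<Psi> \<xi> \<mu> I2 J2)"
    if adm: "admissible_intervals (A \<times> U2) J \<xi> \<mu> I2 J2" for I2 J2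
  proof -
    have V: "(s, deriv \<xi> t, \<mu> t, \<xi> t, t) \<in> A \<times> U2" if "s \<in> I2" "t \<in> J2" for s t
      using adm that unfolding admissible_intervals_def by blast
    have IJ: "open I2" "open J2" "J2 \<subseteq> J"
      using adm by (auto simp: admissible_intervals_def open_interval_def)
    \<comment> \<open>The map \<open>Phi2 \<alpha>\<close> preserves \<open>x\<close>,
      \<open>p\<close> and \<open>q\<close>, so its inverse does too; \<open>phi2\<close> and
      \<open>psi2\<close> supply the two remaining components.\<close>
    have \<Psi>S: "(s, phi2 \<Psi> (s, deriv \<xi> t, \<mu> t, \<xi> t, t), psi2 \<Psi> (s, deriv \<xi> t, \<mu> t, \<xi> t, t), \<xi> t, t)
        = \<Psi> (s, deriv \<xi> t, \<mu> t, \<xi> t, t)" if "s \<in> I2" "t \<in> J2" for s t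
      using maps[OF V[OF that]] by (auto simp: phi2_def psi2_def Phi2_eq prod_eq_iff)
    have S: "S2 \<Psi> \<xi> \<mu> I2 J2 = {\<Psi> (s, deriv \<xi> t, \<mu> t, \<xi> t, t) | s t. s \<in> I2 \<and> t \<in> J2}"
      unfolding S2_def using \<Psi>S by (intro Collect_cong) metis
    have sub: "submanifold 2 M (S2 \<Psi> \<xi> \<mu> I2 J2)"
      unfolding S using IJ \<xi>' \<mu> assms(9) V
      by (intro submanifold_of_graph[OF dif WM]) (auto intro: smooth_on_mono)
    have R: "jq P \<in> J \<and> jp P - \<xi> (jq P) = 0 \<and> \<alpha> P - deriv \<xi> (jq P) = 0 \<and>
        jz P - jp P * jx P - jq P * jy P - \<mu> (jq P) = 0 \<and>
        jy P + deriv \<xi> (jq P) * jx P + deriv \<mu> (jq P) = 0" if P2: "P \<in> S2 \<Psi> \<xi> \<mu> I2 J2" for P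
    proof -
      obtain s t where P: "P = \<Psi> (s, deriv \<xi> t, \<mu> t, \<xi> t, t)" and st: "s \<in> I2" "t \<in> J2"
        using P2 unfolding S by blast
      have t: "t \<in> J" using st IJ by auto
      have "Phi2 \<alpha> P = (s, deriv \<xi> t, \<mu> t, \<xi> t, t)" using maps[OF V[OF st]] P by simp
      \<comment> \<open>The differential equation is stated for \<open>beta_bar\<close>, which may
        be evaluated as \<beta> at the actual first coordinate \<open>s\<close> of
        \<open>P\<close>.\<close>
      moreover have "beta \<alpha> P = - deriv \<mu> t"
        using bbar[of "(deriv \<xi> t, \<mu> t, \<xi> t, t)" s] V[OF st] ode(3)[OF t] P by simp
      ultimately show ?thesis using t by (auto simp: Phi2_eq beta_eq)
    qed
    have "pullback_vanishes (S2 \<Psi> \<xi> \<mu> I2 J2) \<omega>" if "\<omega> \<in> system_ideal M \<alpha>" for \<omega>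
      using sub R that
      by (intro system_ideal_pullback_vanishes[OF \<alpha> _ opJ assms(9) \<mu>]) (auto simp: submanifold_def)
    then show ?thesis using sub by (simp add: integral_manifold_def)
  qed
  ultimately show ?thesis by blast
qed

end
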